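(* Let $(X,d)$ be a finite ultrametric space with $|X|\ge 2$. Then the following statements are equivalent: (i) $(X,d)\in\mathfrak{R}$, i.e. $\min_{g\in \operatorname{Iso}(X)}|\operatorname{Fix}(g)|=|X|-2$; (ii) $|\operatorname{Iso}(X)|=2$; (iii) the representing tree $T_X$ is strictly binary with exactly one inner node at each level except the last level.
   Context: An ultrametric space is a metric space with $d(x,y)\le\max\{d(x,z),d(z,y)\}$ for all $x,y,z$. $\operatorname{Iso}(X)$ is the group of isometries of $(X,d)$ (bijective distance-preserving maps $X\to X$), and $\operatorname{Fix}(g)=\{x\in X: g(x)=x\}$. $\mathfrak{R}$ denotes the class of all finite ultrametric spaces $(X,d)$ with $\min_{g\in \operatorname{Iso}(X)}|\operatorname{Fix}(g)|=|X|-2$. Diametrical graph: for a finite ultrametric space $X$ with $|X|\ge2$, $G_X$ is the graph with vertex set $X$ in which $u,v$ are adjacent iff $d(u,v)=\operatorname{diam}X$. It is known that $G_X$ is complete $k$-partite for some $k\ge2$, $G_X=G_X[X_1,\dots,X_k]$ (nonempty disjoint parts $X_i$ with union $X$; two vertices are adjacent iff they lie in different parts). Representing tree $T_X$ of a finite nonempty ultrametric space: a labeled rooted tree whose nodes are subsets of $X$. The root is $X$, labeled $\operatorname{diam}X$. If $|X|=1$ the tree has only the root, labeled $0$. If $|X|\ge2$ and $G_X=G_X[X_1,\dots,X_k]$, the children of the root are $X_1,\dots,X_k$ with labels $l(X_i)=\operatorname{diam}X_i$. Nodes with label $0$ (one-point sets) are leaves; nodes with positive label are inner (internal) nodes, and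 the construction is repeated for each of them, with that node in place of $X$. Levels: the root has level $0$, and a child of a node of level $m$ has level $m+1$; the last level is the largest level occurring. A rooted tree is strictly binary if every inner node has exactly two children. *)

theory Defs
  imports "HOL-Analysis.Analysis" "HOL-Algebra.Bij" "HOL-Library.Disjoint_Sets"
begin

section \<open>Finite ultrametric spaces and their isometries\<close>

text \<open>Spaces are pairs of a carrier set and a distance function. The values of the distance
  outside the carrier are irrelevant to all notions below (the locale \<^locale>\<open>Metric_space\<close>
  merely asks that it is nonnegative and symmetric there as well).\<close>

locale ultrametric_space = Metric_space X d
  for X :: "'a set" and d :: "'a \<Rightarrow> 'a \<Rightarrow> real" +
  assumes ultrametric: "\<lbrakk>x \<in> X; y \<in> X; z \<in> X\<rbrakk> \<Longrightarrow> d x y \<le> max (d x z) (d z y)"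

locale finite_ultrametric_space = ultrametric_space +
  assumes finite_space: "finite X"

text \<open>Self-maps of \<open>X\<close> are represented by functions that are \<^const>\<open>undefined\<close>
  outside \<open>X\<close> (see \<^const>\<open>Bij\<close>), so that isometries can be counted.\<close>

definition Iso :: "'a set \<Rightarrow> ('a \<Rightarrow> 'a \<Rightarrow> real) \<Rightarrow> ('a \<Rightarrow> 'a) set" where
  "Iso X d = {g \<in> Bij X. \<forall>x\<in>X. \<forall>y\<in>X. d (g x) (g y) = d x y}"

definition Fix :: "'a set \<Rightarrow> ('a \<Rightarrow> 'a) \<Rightarrow> 'a set" where
  "Fix X g = {x \<in> X. g x = x}"

lemma subgroup_Iso: "subgroup (Iso X d) (BijGroup X)"
proof (rule group.subgroupI[OF group_BijGroup])
  show "Iso X d \<subseteq> carrier (BijGroup X)"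
    by (auto simp: Iso_def BijGroup_def)
  have "(\<lambda>x\<in>X. x) \<in> Iso X d"
    by (auto simp: Iso_def id_Bij)
  then show "Iso X d \<noteq> {}" by blast
next
  fix g assume g: "g \<in> Iso X d"
  then have gB: "g \<in> Bij X" by (simp add: Iso_def)
  have inv: "inv_into X g x \<in> X" "g (inv_into X g x) = x" if "x \<in> X" for x
    using gB that by (auto simp: Bij_inv_into_mem Bij_def bij_betw_def f_inv_into_f)
  have "d (inv_into X g x) (inv_into X g y) = d x y" if "x \<in> X" "y \<in> X" for x y
    using g inv[OF that(1)] inv[OF that(2)] by (fastforce simp: Iso_def)
  then show "inv\<^bsub>BijGroup X\<^esub> g \<in> Iso X d"
    using gB by (simp add: inv_BijGroup Iso_def restrict_inv_into_Bij)
next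
  fix g h assume gh: "g \<in> Iso X d" "h \<in> Iso X d"
  then have B: "g \<in> Bij X" "h \<in> Bij X" by (simp_all add: Iso_def)
  from gh show "g \<otimes>\<^bsub>BijGroup X\<^esub> h \<in> Iso X d"
    using Bij_imp_funcset[OF B(2)] compose_Bij[OF B]
    by (auto simp: Iso_def BijGroup_def compose_eq Pi_iff)
qed

text \<open>The difference is taken in the integers, since it is negative for one-point spaces.\<close>

definition class_R :: "('a set \<times> ('a \<Rightarrow> 'a \<Rightarrow> real)) set" where
  "class_R = {(X, d). finite_ultrametric_space X d \<and>
     int (MIN g\<in>Iso X d. card (Fix X g)) = int (card X) - 2}"


section \<open>Diametrical graphs\<close>

text \<open>The analogue of \<^const>\<open>diameter\<close> for an explicit distance function.\<close>

definition diam :: "('a \<Rightarrow> 'a \<Rightarrow> real) \<Rightarrow> 'a set \<Rightarrow> real" where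
  "diam d A = (if A = {} then 0 else SUP (x, y)\<in>A \<times> A. d x y)"

text \<open>Graphs on a vertex set \<open>V\<close> are given by their symmetric adjacency relation.\<close>

definition diametrical_graph :: "('a \<Rightarrow> 'a \<Rightarrow> real) \<Rightarrow> 'a set \<Rightarrow> ('a \<times> 'a) set" where
  "diametrical_graph d A = {(u, v) \<in> A \<times> A. d u v = diam d A}"

definition complete_partite :: "'a set \<Rightarrow> ('a \<times> 'a) set \<Rightarrow> 'a set set \<Rightarrow> bool" where
  "complete_partite V E P \<longleftrightarrow> partition_on V P \<and> E \<subseteq> V \<times> V \<and>
     (\<forall>u\<in>V. \<forall>v\<in>V. (u, v) \<in> E \<longleftrightarrow> \<not> (\<exists>B\<in>P. u \<in> B \<and> v \<in> B))"

text \<open>The set of parts of the diametrical graph. It is well defined whenever \<open>A\<close> is finite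
  with at least two points, see \<open>diametrical_parts\<close> below.\<close>

definition diametrical_parts :: "('a \<Rightarrow> 'a \<Rightarrow> real) \<Rightarrow> 'a set \<Rightarrow> 'a set set" where
  "diametrical_parts d A = (THE P. complete_partite A (diametrical_graph d A) P \<and> 2 \<le> card P)"

lemma complete_partite_part:
  assumes cp: "complete_partite V E P" and B: "B \<in> P" "u \<in> B"
  shows "B = {v \<in> V. (u, v) \<notin> E}"
proof -
  have P: "partition_on V P" using cp by (simp add: complete_partite_def)
  have sub: "C \<subseteq> V" if "C \<in> P" for C
    using P that by (auto simp: partition_on_def)
  have disj: "C = B" if "C \<in> P" "u \<in> C" for C
    using partition_onD2[OF P] B that by (meson disjointD disjoint_iff)
  have E: "(u, v) \<in> E \<longleftrightarrow> \<not> (\<exists>C\<in>P. u \<in> C \<and> v \<in> C)" if "v \<in> V" for v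
    using cp that B sub[OF B(1)] unfolding complete_partite_def by (meson subsetD)
  show ?thesis
  proof (rule equalityI; rule subsetI)
    fix v assume "v \<in> B"
    with sub[OF B(1)] E B show "v \<in> {v \<in> V. (u, v) \<notin> E}" by blast
  next
    fix v assume "v \<in> {v \<in> V. (u, v) \<notin> E}"
    with E obtain C where "C \<in> P" "u \<in> C" "v \<in> C" by blast
    with disj show "v \<in> B" by simp
  qed
qed

lemma complete_partite_unique:
  assumes P: "complete_partite V E P" and Q: "complete_partite V E Q"
  shows "P = Q"
proof -
  have "P \<subseteq> Q" if P: "complete_partite V E P" and Q: "complete_partite V E Q" for P Q
  proof
    fix B assume B: "B \<in> P"
    have pP: "partition_on V P" and pQ: "partition_on V Q"
      using P Q by (simp_all add: complete_partite_def)
    from B partition_onD3[OF pP] obtain u where u: "u \<in> B" by fastforce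
    with B partition_onD1[OF pP] partition_onD1[OF pQ] obtain C where C: "C \<in> Q" "u \<in> C"
      by blast
    have "B = C"
      using complete_partite_part[OF P B u] complete_partite_part[OF Q C] by simp
    with C show "B \<in> Q" by simp
  qed
  with P Q show ?thesis by blast
qed

context ultrametric_space
begin

lemma diam_attained:
  assumes "finite A" "A \<noteq> {}"
  shows "\<exists>x\<in>A. \<exists>y\<in>A. diam d A = d x y" and "x \<in> A \<Longrightarrow> y \<in> A \<Longrightarrow> d x y \<le> diam d A"
proof -
  let ?D = "(\<lambda>(x, y). d x y) ` (A \<times> A)"
  have D: "finite ?D" "?D \<noteq> {}" using assms by auto
  then have "diam d A = Max ?D"
    using assms by (simp add: diam_def cSup_eq_Max)
  then show "\<exists>x\<in>A. \<exists>y\<in>A. diam d A = d x y" "x \<in> A \<Longrightarrow> y \<in> A \<Longrightarrow> d x y \<le> diam d A"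
    using Max_in[OF D] Max_ge[OF D(1), of "d x y"] by auto
qed

lemma ex_complete_partite:
  assumes A: "A \<subseteq> X" "finite A" "2 \<le> card A"
  shows "\<exists>P. complete_partite A (diametrical_graph d A) P \<and> 2 \<le> card P"
proof -
  have "A \<noteq> {}" using A by auto
  note diam = diam_attained[OF A(2) this]
  obtain a b where ab: "a \<in> A" "b \<in> A" "a \<noteq> b"
    using A by (metis card_le_Suc0_iff_eq not_less_eq_eq numeral_2_eq_2)
  have pos: "0 < diam d A"
    using ab A diam(2)[OF ab(1,2)] mdist_pos_less[of a b] by fastforce
  define r where "r = {(u, v) \<in> A \<times> A. d u v < diam d A}"
  have tr: "d u w < diam d A"
    if "u \<in> A" "v \<in> A" "w \<in> A" "d u v < diam d A" "d v w < diam d A" for u v w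
    using ultrametric[of u w v] that A by fastforce
  have eqv: "equiv A r"
    by (rule equivI)
      (use tr pos A in \<open>auto simp: r_def refl_on_def sym_def trans_def commute subset_iff\<close>)
  have part: "partition_on A (A // r)"
    using eqv by (rule partition_on_quotient)
  have same: "(\<exists>B\<in>A // r. u \<in> B \<and> v \<in> B) \<longleftrightarrow> (u, v) \<in> r" if "u \<in> A" "v \<in> A" for u v
    using that eqv by (meson equiv_class_self in_quotient_imp_in_rel insert_subset empty_subsetI
        quotientI Image_singleton_iff)
  have cp: "complete_partite A (diametrical_graph d A) (A // r)"
    unfolding complete_partite_def
  proof (intro conjI ballI part)
    fix u v assume uv: "u \<in> A" "v \<in> A"
    have "(u, v) \<in> diametrical_graph d A \<longleftrightarrow> \<not> (u, v) \<in> r"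
      using uv diam(2)[OF uv] by (auto simp: diametrical_graph_def r_def)
    with same[OF uv] show
      "(u, v) \<in> diametrical_graph d A \<longleftrightarrow> \<not> (\<exists>B\<in>A // r. u \<in> B \<and> v \<in> B)"
      by simp
  qed (auto simp: diametrical_graph_def)
  obtain x y where xy: "x \<in> A" "y \<in> A" "diam d A = d x y"
    using diam(1) by blast
  have ne: "r `` {x} \<noteq> r `` {y}"
  proof
    assume "r `` {x} = r `` {y}"
    then have "(x, y) \<in> r" using eq_equiv_class[OF _ eqv xy(2)] by blast
    with xy(3) show False by (simp add: r_def)
  qed
  have fin: "finite (A // r)"
    using A(2) by (simp add: quotient_def)
  have sub: "{r `` {x}, r `` {y}} \<subseteq> A // r"
    using xy by (auto simp: quotientI)
  have "2 \<le> card (A // r)"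
    using card_mono[OF fin sub] ne by simp
  with cp show ?thesis by blast
qed

lemma diametrical_parts:
  assumes "A \<subseteq> X" "finite A" "2 \<le> card A"
  shows "complete_partite A (diametrical_graph d A) (diametrical_parts d A)"
    and "2 \<le> card (diametrical_parts d A)"
proof -
  let ?parts = "\<lambda>P. complete_partite A (diametrical_graph d A) P \<and> 2 \<le> card P"
  from ex_complete_partite[OF assms] obtain P where P: "?parts P" ..
  then have "?parts (THE P. ?parts P)"
    by (rule theI) (metis P complete_partite_unique)
  then show "complete_partite A (diametrical_graph d A) (diametrical_parts d A)"
    "2 \<le> card (diametrical_parts d A)"
    unfolding diametrical_parts_def by simp_all
qed

end


section \<open>Labeled rooted trees and the representing tree\<close>

record 'v labeled_tree =
  root :: 'v
  children :: "'v \<Rightarrow> 'v set"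
  label :: "'v \<Rightarrow> real"

definition level :: "'v labeled_tree \<Rightarrow> nat \<Rightarrow> 'v set" where
  "level T n = ({(u, v). v \<in> children T u} ^^ n) `` {root T}"

definition nodes :: "'v labeled_tree \<Rightarrow> 'v set" where
  "nodes T = (\<Union>n. level T n)"

definition inner_nodes :: "'v labeled_tree \<Rightarrow> 'v set" where
  "inner_nodes T = {v \<in> nodes T. 0 < label T v}"

definition last_level :: "'v labeled_tree \<Rightarrow> nat" where
  "last_level T = Max {n. level T n \<noteq> {}}"

definition strictly_binary :: "'v labeled_tree \<Rightarrow> bool" where
  "strictly_binary T \<longleftrightarrow> (\<forall>v\<in>inner_nodes T. card (children T v) = 2)"

text \<open>One-point sets are the sets of diameter \<open>0\<close> among the nodes; they are leaves.\<close>

definition representing_tree :: "'a set \<Rightarrow> ('a \<Rightarrow> 'a \<Rightarrow> real) \<Rightarrow> 'a set labeled_tree" where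
  "representing_tree X d =
     \<lparr>root = X,
      children = (\<lambda>A. if 0 < diam d A then diametrical_parts d A else {}),
      label = diam d\<rparr>"

end

theory Submission
  imports Defs "HOL-Combinatorics.Transposition"
begin

text \<open>Call two points twins if they have the same distance to every other point; the
  transposition of twins is an isometry. By the ultrametric inequality a pair of points at minimal
  positive distance consists of twins, so twins always exist, and two different pairs of twins yield
  an isometry that moves at least three points. Hence each of (i) and (ii) forces the pair of twins
  to be unique. As every part of the diametrical graph with at least two points contains twins of the
  whole space, and two one-point parts are twins, uniqueness means that the space arises from a
  point by repeatedly adding one point that is farther away than everything before. These are
  exactly the spaces whose representing tree is as in (iii), and only the first two points can be
  interchanged by an isometry.\<close>

hide_const (open) Finite_Cartesian_Product.transpose

section \<open>Twins\<close>

definition twins :: "('a \<Rightarrow> 'a \<Rightarrow> real) \<Rightarrow> 'a set \<Rightarrow> 'a \<Rightarrow> 'a \<Rightarrow> bool" where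
  "twins d A x y \<longleftrightarrow> x \<in> A \<and> y \<in> A \<and> x \<noteq> y \<and> (\<forall>z\<in>A - {x, y}. d x z = d y z)"

definition unique_twins :: "('a \<Rightarrow> 'a \<Rightarrow> real) \<Rightarrow> 'a set \<Rightarrow> bool" where
  "unique_twins d A \<longleftrightarrow> (\<forall>x y u v. twins d A x y \<longrightarrow> twins d A u v \<longrightarrow> {x, y} = {u, v})"

text \<open>The premise of \<open>insert\<close> compares \<open>d a b\<close> only with distances
  at the same \<open>b\<close>. In an ultrametric space this already makes all distances from
  \<open>a\<close> to \<open>B\<close> equal and larger than every distance within \<open>B\<close>,
  see \<open>dist_insert_far\<close>.\<close>

inductive caterpillar :: "('a \<Rightarrow> 'a \<Rightarrow> real) \<Rightarrow> 'a set \<Rightarrow> bool" for d where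
  point: "caterpillar d {x}"
| insert: "\<lbrakk>caterpillar d B; a \<notin> B; \<And>b c. b \<in> B \<Longrightarrow> c \<in> B \<Longrightarrow> d b c < d a b\<rbrakk>
    \<Longrightarrow> caterpillar d (insert a B)"

lemma caterpillar_finite: "caterpillar d A \<Longrightarrow> finite A \<and> A \<noteq> {}"
  by (induction rule: caterpillar.induct) auto

lemma singleton_if_card_less_2:
  assumes "finite A" "A \<noteq> {}" "\<not> 2 \<le> card A"
  shows "\<exists>x. A = {x}"
proof -
  have "card A \<noteq> 0" using assms(1,2) by simp
  then have "card A = 1" using assms(3) by linarith
  then show ?thesis by (simp add: card_1_singleton_iff)
qed

section \<open>Isometries, and the existence of twins\<close>

lemma id_in_Iso: "(\<lambda>x\<in>X. x) \<in> Iso X d"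
  by (auto simp: Iso_def id_Bij)

lemma compose_in_Iso:
  assumes "g \<in> Iso X d" "h \<in> Iso X d"
  shows "compose X g h \<in> Iso X d"
  using assms Bij_imp_funcset[of h X] compose_Bij[of g X h]
  by (auto simp: Iso_def compose_eq Pi_iff)

lemma Iso_finite: "finite X \<Longrightarrow> finite (Iso X d)"
  by (rule finite_subset[OF _ finite_PiE[of X "\<lambda>_. X"]])
    (auto simp: Iso_def Bij_def bij_betw_def PiE_def)

context ultrametric_space
begin

lemma twins_transpose_in_Iso:
  assumes "twins d X x y"
  shows "restrict (transpose x y) X \<in> Iso X d"
proof -
  have xy: "x \<in> X" "y \<in> X" "x \<noteq> y" and tw: "\<And>z. z \<in> X \<Longrightarrow> z \<noteq> x \<Longrightarrow> z \<noteq> y \<Longrightarrow> d x z = d y z"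
    using assms by (auto simp: twins_def)
  have im: "transpose x y ` X = X"
    using xy by (simp add: transpose_image_eq)
  then have "bij_betw (restrict (transpose x y) X) X X"
    by (simp add: bij_betw_def inj_on_restrict_eq)
  moreover have "d (transpose x y u) (transpose x y v) = d u v" if "u \<in> X" "v \<in> X" for u v
    using tw[of u] tw[of v] that xy
    by (auto simp: Transposition.transpose_def commute)
  ultimately show ?thesis
    by (auto simp: Iso_def Bij_def)
qed

lemma ex_twins:
  assumes "A \<subseteq> X" "finite A" "2 \<le> card A"
  shows "\<exists>x y. twins d A x y"
proof -
  define S where "S = {(x, y) \<in> A \<times> A. x \<noteq> y}"
  have "S \<subseteq> A \<times> A" by (auto simp: S_def)
  then have fin: "finite S" using assms(2) by (meson finite_SigmaI finite_subset)
  have "S \<noteq> {}"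
    using assms(2,3) card_le_Suc0_iff_eq[of A] by (auto simp: S_def)
  then obtain p where p: "p \<in> S" "\<And>q. q \<in> S \<Longrightarrow> case_prod d p \<le> case_prod d q"
    using ex_is_arg_min_if_finite[OF fin, of "case_prod d"]
    by (auto simp: is_arg_min_linorder)
  obtain x y where xy: "p = (x, y)" by fastforce
  have m: "d x y \<le> d u v" if "u \<in> A" "v \<in> A" "u \<noteq> v" for u v
    using p(2)[of "(u, v)"] that xy by (auto simp: S_def)
  have "x \<in> A" "y \<in> A" "x \<noteq> y" using p(1) xy by (auto simp: S_def)
  moreover have "d x z = d y z" if "z \<in> A" "z \<noteq> x" "z \<noteq> y" for z
  proof (rule antisym)
    have X: "x \<in> X" "y \<in> X" "z \<in> X" using \<open>x \<in> A\<close> \<open>y \<in> A\<close> that assms(1) by auto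
    \<comment> \<open>Going from \<open>x\<close> to \<open>z\<close> through \<open>y\<close>, the
      maximum is \<open>d y z\<close>, because \<open>d x y\<close> is minimal among the positive
      distances in \<open>A\<close>.\<close>
    show "d x z \<le> d y z"
      using ultrametric[OF X(1,3,2)] m[of y z] \<open>y \<in> A\<close> that by auto
    show "d y z \<le> d x z"
      using ultrametric[OF X(2,3,1)] m[of x z] \<open>x \<in> A\<close> that by (auto simp: commute)
  qed
  ultimately show ?thesis by (auto simp: twins_def)
qed

section \<open>From (ii) and from (i) to the uniqueness of twins\<close>

lemma unique_twins_if_card_Iso:
  assumes "card (Iso X d) = 2"
  shows "unique_twins d X"
  unfolding unique_twins_def
proof (intro allI impI)
  fix x y u v assume tw: "twins d X x y" "twins d X u v"
  let ?t = "\<lambda>x y. restrict (transpose x y) X"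
  have ne: "?t p q \<noteq> (\<lambda>x\<in>X. x)" if "twins d X p q" for p q
    using that by (auto simp: twins_def dest!: fun_cong[of _ _ p])
  \<comment> \<open>One of the two isometries is the identity, and neither transposition is; so both
    are the other one.\<close>
  have "?t x y = ?t u v"
    using assms twins_transpose_in_Iso[OF tw(1)] twins_transpose_in_Iso[OF tw(2)] id_in_Iso[of X d]
      ne[OF tw(1)] ne[OF tw(2)]
    unfolding card_2_iff by (metis insertE singletonD)
  then have "transpose x y z = transpose u v z" if "z \<in> X" for z
    using that by (metis restrict_apply')
  from this[of x] this[of y] have "transpose u v x = y" "transpose u v y = x" "x \<noteq> y"
    using tw by (simp_all add: twins_def)
  then have "x \<in> {u, v}" "y \<in> {u, v}" "x \<noteq> y"
    by (metis insertCI transpose_apply_other)+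
  then show "{x, y} = {u, v}" by blast
qed

text \<open>For two different pairs of twins, the composite of the two transpositions is an isometry
  with at most |X| - 3 fixed points, below the minimum prescribed by \<open>class_R\<close>.\<close>

lemma unique_twins_if_class_R:
  assumes R: "(X, d) \<in> class_R" and fin: "finite X"
  shows "unique_twins d X"
  unfolding unique_twins_def
proof (intro allI impI, rule ccontr)
  fix x y u v assume tw: "twins d X x y" "twins d X u v" and ne: "{x, y} \<noteq> {u, v}"
  define g where "g = compose X (restrict (transpose x y) X) (restrict (transpose u v) X)"
  have g: "g \<in> Iso X d"
    unfolding g_def using tw by (intro compose_in_Iso twins_transpose_in_Iso)
  have sub: "{x, y, u, v} \<subseteq> X" and xyuv: "x \<noteq> y" "u \<noteq> v" using tw by (auto simp: twins_def)
  have geq: "g z = transpose x y (transpose u v z)" if "z \<in> X" for z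
  proof -
    have "transpose u v z \<in> X" using sub that by (auto simp: Transposition.transpose_def)
    then show ?thesis using that by (simp add: g_def compose_eq)
  qed
  \<comment> \<open>Disjoint pairs are both swapped, and pairs with one common point give a 3-cycle;
    either way no point of the union is fixed.\<close>
  have "Fix X g \<subseteq> X - {x, y, u, v}"
    using sub xyuv ne by (auto simp: Fix_def geq Transposition.transpose_def split: if_splits)
  then have "card (Fix X g) \<le> card X - card {x, y, u, v}"
    using fin sub by (metis card_Diff_subset card_mono finite_Diff finite_subset)
  moreover have "3 \<le> card {x, y, u, v}"
  proof -
    have "u \<notin> {x, y} \<or> v \<notin> {x, y}" using ne xyuv by auto
    then obtain w where w: "w \<in> {u, v}" "w \<notin> {x, y}" by auto
    have "card {x, y, w} = 3" using xyuv w by auto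
    moreover have "card {x, y, w} \<le> card {x, y, u, v}"
      using w by (intro card_mono) auto
    ultimately show ?thesis by simp
  qed
  \<comment> \<open>Guards against truncation in the natural-number difference that bounds
    \<open>card (Fix X g)\<close>.\<close>
  moreover have "card {x, y, u, v} \<le> card X" using sub fin by (rule card_mono[rotated])
  ultimately have "int (card (Fix X g)) < int (card X) - 2" by linarith
  moreover have "(MIN g\<in>Iso X d. card (Fix X g)) \<le> card (Fix X g)"
    using g Iso_finite[OF fin] by (intro Min_le) auto
  ultimately show False using R by (auto simp: class_R_def)
qed

section \<open>Diametrical parts\<close>

lemma diam_pos_iff:
  assumes "A \<subseteq> X" "finite A"
  shows "0 < diam d A \<longleftrightarrow> 2 \<le> card A"
proof
  assume pos: "0 < diam d A"
  then have "A \<noteq> {}" by (auto simp: diam_def)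
  from diam_attained(1)[OF assms(2) this] obtain x y where xy: "x \<in> A" "y \<in> A" "diam d A = d x y"
    by blast
  then have "x \<noteq> y" using pos assms by auto
  then show "2 \<le> card A" using card_mono[OF assms(2), of "{x, y}"] xy by auto
next
  assume "2 \<le> card A"
  then obtain a b where ab: "a \<in> A" "b \<in> A" "a \<noteq> b"
    using assms by (metis card_le_Suc0_iff_eq not_less_eq_eq numeral_2_eq_2)
  moreover have "A \<noteq> {}" using ab by auto
  ultimately show "0 < diam d A"
    using assms diam_attained(2)[OF assms(2), of a b] mdist_pos_less[of a b] by fastforce
qed

lemma diametrical_parts_dist:
  assumes A: "A \<subseteq> X" "finite A" "2 \<le> card A"
    and B: "B \<in> diametrical_parts d A" "b \<in> B" and c: "c \<in> A"
  shows "c \<in> B \<Longrightarrow> d b c < diam d A" and "c \<notin> B \<Longrightarrow> d b c = diam d A"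
proof -
  note cp = diametrical_parts(1)[OF A]
  have "B \<subseteq> A" using cp B(1) by (auto simp: complete_partite_def partition_on_def)
  moreover have "A \<noteq> {}" using c by auto
  ultimately have "b \<in> A" "d b c \<le> diam d A"
    using diam_attained(2)[OF A(2), of b c] B c by auto
  moreover have "c \<in> B \<longleftrightarrow> (b, c) \<notin> diametrical_graph d A"
    using complete_partite_part[OF cp B] c by blast
  ultimately show "c \<in> B \<Longrightarrow> d b c < diam d A" "c \<notin> B \<Longrightarrow> d b c = diam d A"
    using c by (auto simp: diametrical_graph_def)
qed

text \<open>Properness makes inductions along the parts well founded. A part equal to
  \<open>A\<close> would contain no pair at distance \<open>diam d A\<close>, although the diameter
  is attained.\<close>

lemma diametrical_part_psubset:
  assumes A: "A \<subseteq> X" "finite A" "2 \<le> card A" and B: "B \<in> diametrical_parts d A"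
  shows "B \<subset> A" "B \<noteq> {}"
proof -
  have p: "partition_on A (diametrical_parts d A)"
    using diametrical_parts(1)[OF A] by (simp add: complete_partite_def)
  then show "B \<noteq> {}" using B by (auto simp: partition_on_def)
  have "B \<subseteq> A" using p B by (auto simp: partition_on_def)
  moreover have "B \<noteq> A"
  proof
    assume "B = A"
    have "A \<noteq> {}" using A by auto
    from diam_attained(1)[OF A(2) this] obtain x y where "x \<in> A" "y \<in> A" "diam d A = d x y"
      by blast
    then show False
      using diametrical_parts_dist(1)[OF A B, of x y] \<open>B = A\<close> by simp
  qed
  ultimately show "B \<subset> A" by blast
qed

lemma diametrical_parts_cover:
  assumes A: "A \<subseteq> X" "finite A" "2 \<le> card A" and "x \<in> A"
  shows "\<exists>B\<in>diametrical_parts d A. x \<in> B"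
  using diametrical_parts(1)[OF A] assms(4) by (auto simp: complete_partite_def partition_on_def)

text \<open>Triangles are isosceles: in \<open>a\<close>, \<open>b\<close>, \<open>c\<close> the
  side \<open>d b c\<close> is strictly shorter than the other two, so these are equal.\<close>

lemma dist_insert_far:
  assumes X: "insert a B \<subseteq> X" and far: "\<And>b c. b \<in> B \<Longrightarrow> c \<in> B \<Longrightarrow> d b c < d a b"
    and bc: "b \<in> B" "c \<in> B"
  shows "d a b = d a c"
proof -
  have "a \<in> X" "b \<in> X" "c \<in> X" using X bc by auto
  then show ?thesis
    using ultrametric[of a b c] ultrametric[of a c b] far[OF bc] far[OF bc(2,1)] commute[of b c]
    by auto
qed

text \<open>One \<open>insert\<close> step of a caterpillar is one binary branching of the tree. The
  lemma serves both to compute the tree of a caterpillar and to recognise \<open>A - {a}\<close> as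
  a diametrical part.\<close>

lemma diametrical_parts_insert:
  assumes X: "insert a B \<subseteq> X" and a: "a \<notin> B" and B: "finite B" "B \<noteq> {}"
    and far: "\<And>b c. b \<in> B \<Longrightarrow> c \<in> B \<Longrightarrow> d b c < d a b"
  shows "diametrical_parts d (insert a B) = {{a}, B}"
proof -
  let ?A = "insert a B"
  have A: "finite ?A" "?A \<noteq> {}" using B by auto
  have card: "2 \<le> card ?A" using B a by (simp add: Suc_le_eq card_gt_0_iff)
  obtain x y where xy: "x \<in> ?A" "y \<in> ?A" "diam d ?A = d x y"
    using diam_attained(1)[OF A] by blast
  have le: "d u v \<le> diam d ?A" if "u \<in> ?A" "v \<in> ?A" for u v
    using diam_attained(2)[OF A that] .
  have pos: "0 < diam d ?A" using diam_pos_iff[OF X A(1)] card by simp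
  \<comment> \<open>The diameter is not attained within \<open>B\<close>, since \<open>far\<close>
    would give a larger distance to \<open>a\<close>. So it is attained at \<open>a\<close>, and all
    distances from \<open>a\<close> to \<open>B\<close> agree.\<close>
  have D: "d a b = diam d ?A" if "b \<in> B" for b
  proof (cases "x \<in> B \<and> y \<in> B")
    case True
    then have "diam d ?A < d a x" using far xy(3) by simp
    then show ?thesis using le[of a x] True by simp
  next
    case False
    moreover have "x \<noteq> y" using pos xy X by auto
    ultimately show ?thesis
      using xy dist_insert_far[OF X far that] by (auto simp: commute)
  qed
  have "complete_partite ?A (diametrical_graph d ?A) {{a}, B}"
    unfolding complete_partite_def
  proof (intro conjI ballI)
    show "partition_on ?A {{a}, B}"
      using a B by (auto simp: partition_on_def disjoint_def)
    show "diametrical_graph d ?A \<subseteq> ?A \<times> ?A" by (auto simp: diametrical_graph_def)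
    fix u v assume uv: "u \<in> ?A" "v \<in> ?A"
    have "d u v < diam d ?A" if "u \<in> B" "v \<in> B"
      using far[OF that] D[OF that(1)] by simp
    then show "(u, v) \<in> diametrical_graph d ?A \<longleftrightarrow> \<not> (\<exists>B\<in>{{a}, B}. u \<in> B \<and> v \<in> B)"
      using uv a D D[unfolded commute[of a]] pos X by (auto simp: diametrical_graph_def)
  qed
  then show ?thesis
    using diametrical_parts(1)[OF X A(1) card] complete_partite_unique by metis
qed

text \<open>All points of \<open>A\<close> outside \<open>B\<close> are at distance
  \<open>diam d A\<close> from every point of \<open>B\<close>, so they cannot tell \<open>x\<close>
  and \<open>y\<close> apart.\<close>

lemma twins_part:
  assumes A: "A \<subseteq> X" "finite A" "2 \<le> card A" and B: "B \<in> diametrical_parts d A"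
    and tw: "twins d B x y"
  shows "twins d A x y"
proof -
  note dist = diametrical_parts_dist(2)[OF A B]
  show ?thesis
    using tw diametrical_part_psubset(1)[OF A B] dist[of x] dist[of y]
    unfolding twins_def by (metis Diff_iff psubsetE subsetD)
qed

section \<open>Spaces with a unique pair of twins\<close>

text \<open>Induction on the size. Uniqueness leaves room for only two diametrical parts, one of
  them a single point \<open>a\<close>; the other part inherits uniqueness through
  \<open>twins_part\<close>.\<close>

lemma caterpillar_if_unique_twins:
  assumes "A \<subseteq> X" "finite A" "A \<noteq> {}" "unique_twins d A"
  shows "caterpillar d A"
  using assms
proof (induction "card A" arbitrary: A rule: less_induct)
  case less
  show ?case
  proof (cases "2 \<le> card A")
    case False
    then obtain x where "A = {x}" using singleton_if_card_less_2 less.prems by metis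
    then show ?thesis by (simp add: caterpillar.point)
  next
    case True
    note A = less.prems(1,2) True
    let ?P = "diametrical_parts d A"
    note dist = diametrical_parts_dist[OF A]
    note sub = diametrical_part_psubset[OF A]
    have uniq: "{x, y} = {u, v}" if "twins d A x y" "twins d A u v" for x y u v
      using less.prems(4) that unfolding unique_twins_def by blast
    have disj: "B = C" if "B \<in> ?P" "C \<in> ?P" "x \<in> B" "x \<in> C" for B C x
      using complete_partite_part[OF diametrical_parts(1)[OF A] that(1,3)]
        complete_partite_part[OF diametrical_parts(1)[OF A] that(2,4)] by simp
    have part: "(\<exists>x. B = {x}) \<or> (\<exists>x y. twins d A x y \<and> {x, y} \<subseteq> B)" if B: "B \<in> ?P" for B
    proof (cases "2 \<le> card B")
      case True
      have "B \<subseteq> X" "finite B" using sub[OF B] A finite_subset by auto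
      from ex_twins[OF this True] obtain x y where xy: "twins d B x y" by blast
      then show ?thesis using twins_part[OF A B xy] by (auto simp: twins_def)
    next
      case False
      have "finite B" using sub[OF B] A finite_subset by auto
      then show ?thesis using singleton_if_card_less_2[OF _ sub(2)[OF B] False] by blast
    qed
    have singles: "twins d A x y" if "{x} \<in> ?P" "{y} \<in> ?P" "x \<noteq> y" for x y
      using dist(2)[OF that(1)] dist(2)[OF that(2)] sub(1)[OF that(1)] sub(1)[OF that(2)] that(3)
      by (auto simp: twins_def)
    have one_big: "(\<exists>x. B = {x}) \<or> (\<exists>x. C = {x})" if BC: "B \<in> ?P" "C \<in> ?P" "B \<noteq> C" for B C
    proof (rule ccontr)
      assume "\<not> ?thesis"
      then obtain x y u v where tw: "twins d A x y" "twins d A u v"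
        and sub: "{x, y} \<subseteq> B" "{u, v} \<subseteq> C"
        using part[OF BC(1)] part[OF BC(2)] by metis
      from uniq[OF tw] sub have "x \<in> B" "x \<in> C" by auto
      with disj[OF BC(1,2)] BC(3) show False by simp
    qed
    obtain B C where BC: "B \<in> ?P" "C \<in> ?P" "B \<noteq> C"
      using diametrical_parts(2)[OF A]
      by (metis card.infinite card_le_Suc0_iff_eq not_less_eq_eq numeral_2_eq_2 zero_le)
    obtain a where a: "{a} \<in> ?P"
      using one_big[OF BC] BC(1,2) by auto
    \<comment> \<open>This \<open>B\<close> replaces the part of that name above; that it is itself
      a part follows only after \<open>far\<close> is established.\<close>
    define B where "B = A - {a}"
    have aA: "a \<in> A" using sub[OF a] by auto
    have AB: "A = insert a B" "a \<notin> B" using aA by (auto simp: B_def)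
    have diam: "d a b = diam d A" if "b \<in> B" for b
      using dist(2)[OF a, of a b] that by (auto simp: B_def)
    \<comment> \<open>Otherwise \<open>b\<close> and \<open>c\<close> lie in different parts, both
      different from \<open>{a}\<close>. One of these two is a single point and thus a twin of
      \<open>a\<close>, and the other yields a second pair of twins.\<close>
    have far: "d b c < d a b" if bc: "b \<in> B" "c \<in> B" for b c
    proof (rule ccontr)
      assume n: "\<not> d b c < d a b"
      obtain P Q where PQ: "P \<in> ?P" "b \<in> P" "Q \<in> ?P" "c \<in> Q"
        using diametrical_parts_cover[OF A] bc by (metis B_def DiffD1)
      have cA: "c \<in> A" "a \<noteq> b" "a \<noteq> c" using bc by (auto simp: B_def)
      have "c \<notin> P" using dist(1)[OF PQ(1,2) cA(1)] n diam[OF bc(1)] by auto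
      then have "P \<noteq> Q" using PQ by auto
      have "a \<notin> P" "a \<notin> Q" using disj[OF a PQ(1), of a] disj[OF a PQ(3), of a] PQ cA by auto
      \<comment> \<open>A part \<open>R\<close> avoiding both \<open>a\<close> and its twin
        \<open>p\<close> contradicts uniqueness: it is a further single point, hence another twin of
        \<open>a\<close>, or it contains twins of its own.\<close>
      have other: False if tw: "twins d A a p" and pR: "p \<notin> R" "a \<notin> R" "R \<in> ?P" for p R
        using part[OF pR(3)]
      proof
        assume "\<exists>r. R = {r}"
        then obtain r where r: "R = {r}" by blast
        then have "twins d A a r" using singles[OF a] pR by auto
        from uniq[OF tw this] show False using pR r tw by (auto simp: twins_def doubleton_eq_iff)
      next
        assume "\<exists>x y. twins d A x y \<and> {x, y} \<subseteq> R"
        then obtain x y where "twins d A x y" "{x, y} \<subseteq> R" by blast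
        with uniq[OF tw this(1)] pR show False by auto
      qed
      from one_big[OF PQ(1,3) \<open>P \<noteq> Q\<close>] show False
      proof
        assume "\<exists>x. P = {x}"
        then have "P = {b}" using PQ(2) by auto
        then have "twins d A a b" using singles[OF a _ cA(2)] PQ(1) by simp
        moreover have "b \<notin> Q" using disj[OF PQ(1,3,2)] \<open>P \<noteq> Q\<close> by auto
        ultimately show False using other \<open>a \<notin> Q\<close> PQ(3) by blast
      next
        assume "\<exists>x. Q = {x}"
        then have "Q = {c}" using PQ(4) by auto
        then have "twins d A a c" using singles[OF a _ cA(3)] PQ(3) by simp
        then show False using other \<open>a \<notin> P\<close> \<open>c \<notin> P\<close> PQ(1) by blast
      qed
    qed
    have B: "insert a B \<subseteq> X" "B \<subseteq> X" "finite B" "B \<noteq> {}"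
      using A AB by auto
    have "B \<in> ?P"
      using diametrical_parts_insert[OF B(1) AB(2) B(3,4) far] AB(1) by simp
    then have "unique_twins d B"
      using twins_part[OF A] uniq unfolding unique_twins_def by blast
    moreover have "card B < card A"
      using AB B by simp
    ultimately have "caterpillar d B"
      using less.hyps B by blast
    then show ?thesis
      using AB far by (simp add: caterpillar.insert)
  qed
qed

section \<open>Isometries of caterpillars\<close>

lemma caterpillar_isometries:
  assumes "caterpillar d A" "A \<subseteq> X" "2 \<le> card A"
  shows "\<exists>x y. twins d A x y \<and>
    (\<forall>g. bij_betw g A A \<longrightarrow> (\<forall>u\<in>A. \<forall>v\<in>A. d (g u) (g v) = d u v) \<longrightarrow>
      (\<forall>z\<in>A. g z = z) \<or> (\<forall>z\<in>A. g z = transpose x y z))"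
  using assms
proof (induction rule: caterpillar.induct)
  case (point x)
  then show ?case by simp
next
  case (insert B a)
  have B: "finite B" "B \<noteq> {}" using caterpillar_finite[OF insert.hyps(1)] by auto
  note far = insert.hyps(3)
  have eq: "d a b = d a c" if "b \<in> B" "c \<in> B" for b c
    using dist_insert_far[OF insert.prems(1) _ that] far by blast
  show ?case
  proof (cases "2 \<le> card B")
    \<comment> \<open>The pair of twins originates here: a bijection of two points is the identity
      or the swap, whatever the distances. Points added later are fixed and keep the pair
      intact.\<close>
    case False
    then obtain b where b: "B = {b}" using singleton_if_card_less_2 B by metis
    have "(\<forall>z\<in>{a, b}. g z = z) \<or> (\<forall>z\<in>{a, b}. g z = transpose a b z)"
      if "bij_betw g {a, b} {a, b}" for g
      using that insert.hyps(2) b by (auto simp: bij_betw_def doubleton_eq_iff)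
    moreover have "twins d {a, b} a b" using insert.hyps(2) b by (auto simp: twins_def)
    ultimately show ?thesis unfolding b by blast
  next
    case True
    have "B \<subseteq> X" using insert.prems by auto
    from insert.IH[OF this True] obtain x y where tw: "twins d B x y" and
      g: "\<And>g. bij_betw g B B \<Longrightarrow> (\<forall>u\<in>B. \<forall>v\<in>B. d (g u) (g v) = d u v) \<Longrightarrow>
      (\<forall>z\<in>B. g z = z) \<or> (\<forall>z\<in>B. g z = transpose x y z)" by blast
    have xy: "x \<in> B" "y \<in> B" using tw by (auto simp: twins_def)
    have "d x a = d y a" using eq[OF xy] by (simp add: commute)
    then have "twins d (insert a B) x y" using tw by (auto simp: twins_def)
    moreover have "(\<forall>z\<in>insert a B. h z = z) \<or> (\<forall>z\<in>insert a B. h z = transpose x y z)"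
      if h: "bij_betw h (insert a B) (insert a B)"
        and iso: "\<forall>u\<in>insert a B. \<forall>v\<in>insert a B. d (h u) (h v) = d u v" for h
    proof -
      \<comment> \<open>If \<open>h a\<close> were in \<open>B\<close>, another point
        \<open>c\<close> of \<open>B\<close> would be the image of some \<open>c'\<close> in
        \<open>B\<close>. Then \<open>h a\<close> and \<open>c\<close> would be as far apart as
        \<open>a\<close> and \<open>c'\<close>, which is too far for two points of
        \<open>B\<close>.\<close>
      have ha: "h a = a"
      proof (rule ccontr)
        assume "h a \<noteq> a"
        then have b: "h a \<in> B" using h by (auto simp: bij_betw_def)
        then obtain c where c: "c \<in> B" "c \<noteq> h a"
          using True B by (metis card_le_Suc0_iff_eq not_less_eq_eq numeral_2_eq_2)
        then have "c \<in> h ` insert a B" using h by (simp add: bij_betw_def)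
        then obtain c' where c': "c' \<in> B" "h c' = c" using c by auto
        have "d (h a) c = d a c'" using iso c' by auto
        also have "\<dots> = d a (h a)" using eq[OF c'(1) b] .
        finally show False using far[OF b c(1)] by simp
      qed
      \<comment> \<open>The induction is stated with \<open>bij_betw\<close> instead of
        \<open>Iso\<close> so that \<open>h\<close> can be reused on \<open>B\<close> without making
        it \<open>undefined\<close> at \<open>a\<close>.\<close>
      then have "bij_betw h B B"
        using h insert.hyps(2) by (auto simp: bij_betw_def)
      from g[OF this] iso have "(\<forall>z\<in>B. h z = z) \<or> (\<forall>z\<in>B. h z = transpose x y z)" by auto
      moreover have "transpose x y a = a" using xy insert.hyps(2) by (auto simp: Transposition.transpose_def)
      ultimately show ?thesis using ha by auto
    qed
    ultimately show ?thesis by blast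
  qed
qed

lemma caterpillar_Iso:
  assumes "caterpillar d X" "2 \<le> card X"
  obtains x y where "twins d X x y" "Iso X d = {\<lambda>z\<in>X. z, restrict (transpose x y) X}"
proof -
  from caterpillar_isometries[OF assms(1) order_refl assms(2)] obtain x y where
    xy: "twins d X x y" and
    g: "\<And>g. bij_betw g X X \<Longrightarrow> (\<forall>u\<in>X. \<forall>v\<in>X. d (g u) (g v) = d u v) \<Longrightarrow>
      (\<forall>z\<in>X. g z = z) \<or> (\<forall>z\<in>X. g z = transpose x y z)" by blast
  have "h = (\<lambda>z\<in>X. z) \<or> h = restrict (transpose x y) X" if "h \<in> Iso X d" for h
  proof -
    have "h \<in> extensional X" using that by (simp add: Iso_def Bij_def)
    moreover have "(\<forall>z\<in>X. h z = z) \<or> (\<forall>z\<in>X. h z = transpose x y z)"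
      using that by (intro g) (auto simp: Iso_def Bij_def)
    ultimately show ?thesis by (auto simp: extensional_def restrict_def)
  qed
  then have "Iso X d = {\<lambda>z\<in>X. z, restrict (transpose x y) X}"
    using id_in_Iso[of X d] twins_transpose_in_Iso[OF xy] by blast
  with xy show ?thesis by (rule that)
qed

lemma caterpillar_card_Iso:
  assumes "caterpillar d X" "2 \<le> card X"
  shows "card (Iso X d) = 2"
proof -
  obtain x y where xy: "twins d X x y" "Iso X d = {\<lambda>z\<in>X. z, restrict (transpose x y) X}"
    using caterpillar_Iso[OF assms] .
  have "(\<lambda>z\<in>X. z) \<noteq> restrict (transpose x y) X"
    using xy(1) by (auto simp: twins_def dest!: fun_cong[of _ _ x])
  then show ?thesis using xy(2) by simp
qed

lemma caterpillar_class_R: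
  assumes "caterpillar d X" "2 \<le> card X"
  shows "(X, d) \<in> class_R"
proof -
  obtain x y where xy: "twins d X x y" "Iso X d = {\<lambda>z\<in>X. z, restrict (transpose x y) X}"
    using caterpillar_Iso[OF assms] .
  have fin: "finite X" using caterpillar_finite[OF assms(1)] by simp
  have "finite_ultrametric_space X d" using fin by unfold_locales
  moreover have "Fix X (\<lambda>z\<in>X. z) = X" by (auto simp: Fix_def)
  moreover have "Fix X (restrict (transpose x y) X) = X - {x, y}"
    using xy(1) by (auto simp: Fix_def twins_def Transposition.transpose_def split: if_splits)
  moreover have "card (X - {x, y}) = card X - 2"
    using xy(1) fin by (subst card_Diff_subset) (auto simp: twins_def)
  \<comment> \<open>The two isometries fix |X| and |X| - 2 points; \<open>2 \<le> card X\<close>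
    lets the truncated difference pass to the integers.\<close>
  ultimately show ?thesis
    using assms(2) by (simp add: class_R_def xy(2) of_nat_diff)
qed

section \<open>The representing tree\<close>

abbreviation tree :: "'a set \<Rightarrow> 'a set labeled_tree" where
  "tree A \<equiv> representing_tree A d"

definition inner_level :: "'a set \<Rightarrow> nat \<Rightarrow> 'a set set" where
  "inner_level A n = {v \<in> level (tree A) n. 0 < diam d v}"

section \<open>Levels and inner nodes, recursively\<close>

lemma level_0: "level (tree A) 0 = {A}"
  by (simp add: level_def representing_tree_def)

text \<open>Children do not depend on the chosen root, so the subtree at \<open>B\<close> is the
  tree of \<open>B\<close>. Paths are split here at their first edge, as inductions on the space
  require, whereas \<open>level_Suc\<close> splits off the last edge.\<close>

lemma level_Suc_root:
  "level (tree A) (Suc n) = (\<Union>B\<in>children (tree A) A. level (tree B) n)"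
proof -
  define R where "R = {(u, v). v \<in> children (tree A) u}"
  have level: "level (tree B) m = (R ^^ m) `` {B}" for B m
    by (simp add: level_def R_def representing_tree_def)
  have "R ^^ Suc n = R O R ^^ n" by (simp add: relpow_commute)
  then show ?thesis
    unfolding level by (auto simp: R_def)
qed

lemma level_Suc:
  "level (tree A) (Suc n) = (\<Union>B\<in>level (tree A) n. children (tree A) B)"
  unfolding level_def by auto

lemma children_tree:
  "children (tree A) B = (if 0 < diam d B then diametrical_parts d B else {})"
  by (simp add: representing_tree_def)

lemma inner_level_0: "inner_level A 0 = (if 0 < diam d A then {A} else {})"
  by (auto simp: inner_level_def level_0)

lemma inner_level_Suc:
  "inner_level A (Suc n) =
    (if 0 < diam d A then \<Union>B\<in>diametrical_parts d A. inner_level B n else {})"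
  by (auto simp: inner_level_def level_Suc_root children_tree)

text \<open>Each edge leads to a proper part and so loses at least one point. This bounds the height
  of the tree.\<close>

lemma level_card:
  assumes "A \<subseteq> X" "finite A" "A \<noteq> {}" "v \<in> level (tree A) n"
  shows "v \<subseteq> A \<and> v \<noteq> {} \<and> card v + n \<le> card A"
  using assms(4)
proof (induction n arbitrary: v)
  case 0
  then show ?case using assms by (simp add: level_0)
next
  case (Suc n)
  then obtain u where u: "u \<in> level (tree A) n" "v \<in> children (tree A) u"
    by (auto simp: level_Suc)
  have IH: "u \<subseteq> A" "u \<noteq> {}" "card u + n \<le> card A" using Suc.IH[OF u(1)] by auto
  have u': "u \<subseteq> X" "finite u" using IH assms finite_subset by auto
  have v: "2 \<le> card u" "v \<in> diametrical_parts d u"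
    using u(2) diam_pos_iff[OF u'] by (auto simp: children_tree split: if_splits)
  note vu = diametrical_part_psubset[OF u' v]
  have "card v < card u" using vu(1) u'(2) by (rule psubset_card_mono[rotated])
  then show ?case using vu IH by auto
qed

lemma level_Suc_empty_iff:
  assumes "A \<subseteq> X" "finite A" "A \<noteq> {}"
  shows "level (tree A) (Suc n) = {} \<longleftrightarrow> inner_level A n = {}"
proof -
  have "diametrical_parts d v \<noteq> {}" if "v \<in> level (tree A) n" "0 < diam d v" for v
  proof -
    have v: "v \<subseteq> X" "finite v" using level_card[OF assms that(1)] assms finite_subset by auto
    show ?thesis using diametrical_parts(2)[OF v] that diam_pos_iff[OF v] by auto
  qed
  then show ?thesis by (auto simp: level_Suc children_tree inner_level_def)
qed

text \<open>Eliminates \<open>last_level\<close>: the nonempty levels form a finite initial segment,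
  and a level has a nonempty successor exactly if it contains an inner node.\<close>

lemma less_last_level_iff:
  assumes "A \<subseteq> X" "finite A" "A \<noteq> {}"
  shows "n < last_level (tree A) \<longleftrightarrow> inner_level A n \<noteq> {}"
proof -
  let ?N = "{n. level (tree A) n \<noteq> {}}"
  have fin: "finite ?N"
    by (rule finite_subset[of _ "{..card A}"]) (use level_card[OF assms] in fastforce)+
  have ne: "0 \<in> ?N" by (simp add: level_0)
  have down: "m \<in> ?N" if "m \<le> k" "k \<in> ?N" for m k
    using that by (induction rule: inc_induct) (auto simp: level_Suc)
  have "n < last_level (tree A) \<longleftrightarrow> Suc n \<in> ?N"
    unfolding last_level_def
    using Max_in[OF fin] Max_ge[OF fin, of "Suc n"] ne down[of "Suc n" "Max ?N"]
    by (metis Suc_le_eq empty_iff)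
  then show ?thesis using level_Suc_empty_iff[OF assms] by simp
qed

text \<open>Statement (iii) in a form suited to induction. Levels before the last have an inner node
  anyway, so "exactly one" becomes "at most one" on all levels, which passes to subtrees.\<close>

definition single_binary_levels :: "'a set \<Rightarrow> bool" where
  "single_binary_levels A \<longleftrightarrow>
    (\<forall>n. \<forall>u\<in>inner_level A n. card (diametrical_parts d u) = 2 \<and> (\<forall>v\<in>inner_level A n. u = v))"

lemma single_binary_levels_iff:
  assumes "A \<subseteq> X" "finite A" "A \<noteq> {}"
  shows "single_binary_levels A \<longleftrightarrow> strictly_binary (tree A) \<and>
    (\<forall>n < last_level (tree A). \<exists>!v. v \<in> level (tree A) n \<and> v \<in> inner_nodes (tree A))"
proof -
  have inner: "inner_nodes (tree A) = (\<Union>n. inner_level A n)"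
    by (auto simp: inner_nodes_def nodes_def inner_level_def representing_tree_def)
  have level: "v \<in> level (tree A) n \<and> v \<in> inner_nodes (tree A) \<longleftrightarrow> v \<in> inner_level A n" for v n
    by (auto simp: inner_nodes_def nodes_def inner_level_def representing_tree_def)
  have binary: "strictly_binary (tree A) \<longleftrightarrow>
      (\<forall>n. \<forall>u\<in>inner_level A n. card (diametrical_parts d u) = 2)"
    by (auto simp: strictly_binary_def inner children_tree inner_level_def)
  have ex1: "(I \<noteq> {} \<longrightarrow> (\<exists>!v. v \<in> I)) \<longleftrightarrow> (\<forall>u\<in>I. \<forall>v\<in>I. u = v)" for I :: "'a set set"
    by blast
  show ?thesis
    unfolding single_binary_levels_def less_last_level_iff[OF assms] level binary ex1
    by (simp only: ball_conj_distrib all_conj_distrib)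
qed

section \<open>Caterpillars and trees with one inner node per level\<close>

lemma single_binary_levels_if_caterpillar:
  assumes "caterpillar d A" "A \<subseteq> X"
  shows "single_binary_levels A"
  using assms
proof (induction rule: caterpillar.induct)
  case (point x)
  then have "diam d {x} = 0" by (simp add: diam_def)
  then have "inner_level {x} n = {}" for n
    by (cases n) (simp_all add: inner_level_0 inner_level_Suc)
  then show ?case by (simp add: single_binary_levels_def)
next
  case (insert B a)
  have B: "finite B" "B \<noteq> {}" using caterpillar_finite[OF insert.hyps(1)] by auto
  note parts = diametrical_parts_insert[OF insert.prems insert.hyps(2) B insert.hyps(3)]
  have "diam d {a} = 0" using insert.prems by (simp add: diam_def)
  then have a: "inner_level {a} n = {}" for n
    by (cases n) (simp_all add: inner_level_0 inner_level_Suc)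
  have "2 \<le> card (insert a B)"
    using B insert.hyps(2) by (simp add: Suc_le_eq card_gt_0_iff)
  then have pos: "0 < diam d (insert a B)"
    using diam_pos_iff[OF insert.prems] B by simp
  \<comment> \<open>\<open>{a}\<close> is a leaf, so below the new root only the inner nodes of
    \<open>B\<close> remain, each one level further down.\<close>
  have S: "inner_level (insert a B) (Suc n) = inner_level B n" for n
    using a pos by (simp add: inner_level_Suc parts)
  have IH: "single_binary_levels B" using insert.IH insert.prems by simp
  have "{a} \<noteq> B" using insert.hyps(2) by auto
  then have "card (diametrical_parts d (insert a B)) = 2" by (simp add: parts)
  moreover have "u = insert a B" if "u \<in> inner_level (insert a B) 0" for u
    using that pos by (simp add: inner_level_0)
  ultimately show ?case
    using IH unfolding single_binary_levels_def by (metis S not0_implies_Suc)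
qed

text \<open>If both children of the root had two points or more, level 1 would contain two inner
  nodes. So one child is a single point, at distance \<open>diam d A\<close> from the other child,
  within which distances are smaller.\<close>

lemma caterpillar_if_single_binary_levels:
  assumes "A \<subseteq> X" "finite A" "A \<noteq> {}" "single_binary_levels A"
  shows "caterpillar d A"
  using assms
proof (induction "card A" arbitrary: A rule: less_induct)
  case less
  show ?case
  proof (cases "2 \<le> card A")
    case False
    then show ?thesis using singleton_if_card_less_2 less.prems caterpillar.point by metis
  next
    case True
    note A = less.prems(1,2) True
    have pos: "0 < diam d A" using diam_pos_iff A by simp
    note sub = diametrical_part_psubset[OF A]
    have "A \<in> inner_level A 0" using pos by (simp add: inner_level_0)
    then have "card (diametrical_parts d A) = 2"
      using less.prems(4) unfolding single_binary_levels_def by blast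
    then obtain P Q where PQ: "diametrical_parts d A = {P, Q}" "P \<noteq> Q"
      by (auto simp: card_2_iff)
    have fin: "finite P" "finite Q" "P \<noteq> {}" "Q \<noteq> {}" "P \<subset> A" "Q \<subset> A" "P \<subseteq> X" "Q \<subseteq> X"
      using sub[of P] sub[of Q] PQ A finite_subset by auto
    have "\<not> 2 \<le> card P \<or> \<not> 2 \<le> card Q"
    proof (rule ccontr)
      assume "\<not> ?thesis"
      then have "P \<in> inner_level A (Suc 0)" "Q \<in> inner_level A (Suc 0)"
        using pos PQ diam_pos_iff fin by (auto simp: inner_level_Suc inner_level_0)
      then show False using less.prems(4) PQ unfolding single_binary_levels_def by blast
    qed
    then obtain a B where aB: "diametrical_parts d A = {{a}, B}" "{a} \<noteq> B"
      using singleton_if_card_less_2[of P] singleton_if_card_less_2[of Q] fin PQ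
      by (metis insert_commute)
    then have B: "B \<in> diametrical_parts d A" and a: "{a} \<in> diametrical_parts d A" by auto
    have p: "partition_on A {{a}, B}"
      using diametrical_parts(1)[OF A] aB by (simp add: complete_partite_def)
    have AB: "A = insert a B" using partition_onD1[OF p] by auto
    have "a \<notin> B" using partition_onD2[OF p] aB(2) by (auto simp: disjoint_def)
    have finB: "finite B" "B \<subseteq> X" using sub(1)[OF B] A finite_subset by auto
    have far: "d b c < d a b" if "b \<in> B" "c \<in> B" for b c
      using diametrical_parts_dist(1)[OF A B that(1), of c]
        diametrical_parts_dist(2)[OF A a, of a b] that AB \<open>a \<notin> B\<close> by (cases "b = a") auto
    \<comment> \<open>The inner nodes of the tree of \<open>B\<close> occur in that of
      \<open>A\<close> one level further down, so the condition on levels is inherited.\<close>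
    have "inner_level B n \<subseteq> inner_level A (Suc n)" for n
      using pos B by (auto simp: inner_level_Suc)
    then have "single_binary_levels B"
      using less.prems(4) unfolding single_binary_levels_def by (meson subsetD)
    moreover have "card B < card A" using sub(1)[OF B] A(2) by (rule psubset_card_mono[rotated])
    ultimately have "caterpillar d B"
      using less.hyps finB sub(2)[OF B] by blast
    then show ?thesis
      unfolding AB using \<open>a \<notin> B\<close> far by (rule caterpillar.insert)
  qed
qed

end

theorem theorem3p4:
  fixes X :: "'a set" and d :: "'a \<Rightarrow> 'a \<Rightarrow> real"
  assumes "finite_ultrametric_space X d"
    and "card X \<ge> 2"
  shows "((X, d) \<in> class_R \<longleftrightarrow> card (Iso X d) = 2) \<and>
         (card (Iso X d) = 2 \<longleftrightarrow>
            strictly_binary (representing_tree X d) \<and>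
            (\<forall>n < last_level (representing_tree X d).
               \<exists>!v. v \<in> level (representing_tree X d) n \<and> v \<in> inner_nodes (representing_tree X d)))"
proof -
  interpret finite_ultrametric_space X d by fact
  have X: "X \<subseteq> X" "finite X" "X \<noteq> {}" using finite_space assms(2) by auto
  have "caterpillar d X \<longleftrightarrow> (X, d) \<in> class_R"
    using caterpillar_class_R unique_twins_if_class_R caterpillar_if_unique_twins X assms(2) by blast
  moreover have "caterpillar d X \<longleftrightarrow> card (Iso X d) = 2"
    using caterpillar_card_Iso unique_twins_if_card_Iso caterpillar_if_unique_twins X assms(2)
    by blast
  moreover have "caterpillar d X \<longleftrightarrow> single_binary_levels X"
    using single_binary_levels_if_caterpillar caterpillar_if_single_binary_levels X by blast
  ultimately show ?thesis using single_binary_levels_iff[OF X] by simp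
qed

end
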